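(* Let $\mu,\lambda$ be regular functions of $\rho>0$ satisfying $\lambda(\rho)=2\rho\mu'(\rho)-2\mu(\rho)$, let $P$ be a smooth function of $\rho$, and let $\varphi$ satisfy $\varphi'(\rho)=\frac{2\mu'(\rho)}{\rho}$. Let $\rho=\rho(t,x)>0$ and $u=u(t,x)\in\mathbb{R}^N$ be smooth, and set $v=u+\nabla\varphi(\rho)$. Then the compressible Navier–Stokes system $$ \begin{cases} \partial_t\rho+\operatorname{div}(\rho u)=0,\\ \partial_t(\rho u)+\operatorname{div}(\rho u\otimes u)-\operatorname{div}(2\mu(\rho)D(u))-\nabla(\lambda(\rho)\operatorname{div}u)+\nabla P(\rho)=0,\\ (\rho,u)_{/t=0}=(\rho_0,u_0) \end{cases} $$ can be equivalently rewritten as $$ \begin{cases} \partial_t\rho-2\Delta\mu(\rho)+\operatorname{div}(\rho v)=0,\\ \rho\,\partial_tv+\rho\,u\cdot\nabla v-\operatorname{div}(\mu(\rho)\operatorname{curl}v)+\nabla P(\rho)=0,\\ (\rho,u)_{/t=0}=(\rho_0,u_0), \end{cases} $$ that is, $(\rho,u)$ satisfies the first system if and only if $(\rho,v)$, with $u=v-\nabla\varphi(\rho)$, satisfies the second.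
   Context: $N\ge2$ is the space dimension. $D(u)=\frac12(\nabla u+{}^t\nabla u)$ is the strain tensor; $(\operatorname{curl}w)_{ij}=\partial_iw_j-\partial_jw_i$ for a vector field $w$; for a matrix field $A$, $(\operatorname{div}A)_j=\sum_i\partial_iA_{ij}$; $(u\cdot\nabla v)_j=\sum_iu_i\partial_iv_j$. *)

theory Defs
  imports "HOL-Analysis.Analysis"
begin

primrec Ck_on :: "nat \<Rightarrow> 'a::euclidean_space set \<Rightarrow> ('a \<Rightarrow> 'b::real_normed_vector) \<Rightarrow> bool" where
  "Ck_on 0 U f \<longleftrightarrow> continuous_on U f"
| "Ck_on (Suc k) U f \<longleftrightarrow>
     (\<forall>x\<in>U. f differentiable (at x)) \<and>
     (\<forall>b\<in>Basis. Ck_on k U (\<lambda>x. frechet_derivative f (at x) b))"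

(* C^infinity on an arbitrary set S: f is the restriction to S of a C^infinity function on an
   open neighbourhood of S. If S itself is open this is the ordinary notion; on
   [0,T) x R^N it means smoothness up to and including the initial time. *)
definition smooth_on :: "'a::euclidean_space set \<Rightarrow> ('a \<Rightarrow> 'b::real_normed_vector) \<Rightarrow> bool" where
  "smooth_on S f \<longleftrightarrow>
     (\<exists>U g. open U \<and> S \<subseteq> U \<and> (\<forall>k. Ck_on k U g) \<and> (\<forall>x\<in>S. g x = f x))"

definition pd :: "'n::finite \<Rightarrow> (real^'n \<Rightarrow> real) \<Rightarrow> real^'n \<Rightarrow> real" where
  "pd i f x = frechet_derivative f (at x) (axis i 1)"

definition grad :: "(real^'n \<Rightarrow> real) \<Rightarrow> real^'n \<Rightarrow> real^'n::finite" where
  "grad f x = (\<chi> i. pd i f x)"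

definition divergence :: "(real^'n \<Rightarrow> real^'n) \<Rightarrow> real^'n::finite \<Rightarrow> real" where
  "divergence w x = (\<Sum>i\<in>UNIV. pd i (\<lambda>y. w y $ i) x)"

definition laplacian :: "(real^'n \<Rightarrow> real) \<Rightarrow> real^'n::finite \<Rightarrow> real" where
  "laplacian f x = divergence (grad f) x"

definition vgrad :: "(real^'n \<Rightarrow> real^'n) \<Rightarrow> real^'n \<Rightarrow> real^'n^'n::finite" where
  "vgrad w x = (\<chi> i j. pd i (\<lambda>y. w y $ j) x)"

definition strain :: "(real^'n \<Rightarrow> real^'n) \<Rightarrow> real^'n \<Rightarrow> real^'n^'n::finite" where
  "strain w x = (1/2) *\<^sub>R (vgrad w x + transpose (vgrad w x))"

definition curl :: "(real^'n \<Rightarrow> real^'n) \<Rightarrow> real^'n \<Rightarrow> real^'n^'n::finite" where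
  "curl w x = (\<chi> i j. pd i (\<lambda>y. w y $ j) x - pd j (\<lambda>y. w y $ i) x)"

definition mdiv :: "(real^'n \<Rightarrow> real^'n^'n) \<Rightarrow> real^'n \<Rightarrow> real^'n::finite" where
  "mdiv A x = (\<chi> j. \<Sum>i\<in>UNIV. pd i (\<lambda>y. A y $ i $ j) x)"

definition tensor :: "real^'n \<Rightarrow> real^'n \<Rightarrow> real^'n^'n::finite" where
  "tensor a b = (\<chi> i j. a $ i * b $ j)"

definition convect :: "(real^'n \<Rightarrow> real^'n) \<Rightarrow> (real^'n \<Rightarrow> real^'n) \<Rightarrow> real^'n \<Rightarrow> real^'n::finite" where
  "convect u v x = (\<chi> j. \<Sum>i\<in>UNIV. u x $ i * pd i (\<lambda>y. v y $ j) x)"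

definition dt :: "(real \<Rightarrow> real^'n \<Rightarrow> 'b::real_normed_vector) \<Rightarrow> real \<Rightarrow> real^'n::finite \<Rightarrow> 'b" where
  "dt f t x = vector_derivative (\<lambda>s. f s x) (at t)"

(* In both systems the time interval is [0,T) with T an extended real (T = \<infinity> allowed): the
   equations hold for 0 < t < T, the initial condition at t = 0. *)
definition compressible_NS ::
  "(real \<Rightarrow> real) \<Rightarrow> (real \<Rightarrow> real) \<Rightarrow> (real \<Rightarrow> real) \<Rightarrow> ereal \<Rightarrow>
   (real^'n \<Rightarrow> real) \<Rightarrow> (real^'n \<Rightarrow> real^'n) \<Rightarrow>
   (real \<Rightarrow> real^'n \<Rightarrow> real) \<Rightarrow> (real \<Rightarrow> real^'n \<Rightarrow> real^'n::finite) \<Rightarrow> bool" where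
  "compressible_NS \<mu> lam P T \<rho>0 u0 \<rho> u \<longleftrightarrow>
     (\<forall>t x. 0 < t \<and> ereal t < T \<longrightarrow>
        dt \<rho> t x + divergence (\<lambda>y. \<rho> t y *\<^sub>R u t y) x = 0) \<and>
     (\<forall>t x. 0 < t \<and> ereal t < T \<longrightarrow>
        dt (\<lambda>s y. \<rho> s y *\<^sub>R u s y) t x
        + mdiv (\<lambda>y. \<rho> t y *\<^sub>R tensor (u t y) (u t y)) x
        - mdiv (\<lambda>y. (2 * \<mu> (\<rho> t y)) *\<^sub>R strain (u t) y) x
        - grad (\<lambda>y. lam (\<rho> t y) * divergence (u t) y) x
        + grad (\<lambda>y. P (\<rho> t y)) x = 0) \<and>
     (\<forall>x. \<rho> 0 x = \<rho>0 x \<and> u 0 x = u0 x)"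

definition velocity_of ::
  "(real \<Rightarrow> real) \<Rightarrow> (real \<Rightarrow> real^'n \<Rightarrow> real) \<Rightarrow> (real \<Rightarrow> real^'n \<Rightarrow> real^'n) \<Rightarrow>
   real \<Rightarrow> real^'n \<Rightarrow> real^'n::finite" where
  "velocity_of \<phi> \<rho> v t x = v t x - grad (\<lambda>y. \<phi> (\<rho> t y)) x"

(* The unknowns are (\<rho>, v); the velocity u occurring in the transport term and in the initial
   condition is v - grad (\<phi>(\<rho>)). *)
definition effective_NS ::
  "(real \<Rightarrow> real) \<Rightarrow> (real \<Rightarrow> real) \<Rightarrow> (real \<Rightarrow> real) \<Rightarrow> ereal \<Rightarrow>
   (real^'n \<Rightarrow> real) \<Rightarrow> (real^'n \<Rightarrow> real^'n) \<Rightarrow>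
   (real \<Rightarrow> real^'n \<Rightarrow> real) \<Rightarrow> (real \<Rightarrow> real^'n \<Rightarrow> real^'n::finite) \<Rightarrow> bool" where
  "effective_NS \<mu> \<phi> P T \<rho>0 u0 \<rho> v \<longleftrightarrow>
     (\<forall>t x. 0 < t \<and> ereal t < T \<longrightarrow>
        dt \<rho> t x - 2 * laplacian (\<lambda>y. \<mu> (\<rho> t y)) x
        + divergence (\<lambda>y. \<rho> t y *\<^sub>R v t y) x = 0) \<and>
     (\<forall>t x. 0 < t \<and> ereal t < T \<longrightarrow>
        \<rho> t x *\<^sub>R dt v t x
        + \<rho> t x *\<^sub>R convect (velocity_of \<phi> \<rho> v t) (v t) x
        - mdiv (\<lambda>y. \<mu> (\<rho> t y) *\<^sub>R curl (v t) y) x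
        + grad (\<lambda>y. P (\<rho> t y)) x = 0) \<and>
     (\<forall>x. \<rho> 0 x = \<rho>0 x \<and> velocity_of \<phi> \<rho> v 0 x = u0 x)"

end

theory Submission
  imports Defs
begin

text \<open>
  Since \<open>\<phi>' = 2 \<mu>' / \<rho>\<close>, the correction satisfies \<open>\<rho> \<nabla>\<phi>(\<rho>) = 2 \<nabla>\<mu>(\<rho>)\<close>, so the two mass equations agree
  pointwise, and \<open>curl v = curl u\<close> because \<open>v - u\<close> is a gradient. Given the mass equation, applying
  the material derivative to \<open>\<nabla>\<phi>(\<rho>)\<close> and commuting it with the gradient gives
  \<open>\<rho> (\<partial>\<^sub>t + u \<cdot> \<nabla>) \<partial>\<^sub>j \<phi>(\<rho>) = - 2 \<rho> \<partial>\<^sub>j (\<mu>' div u) - 2 \<Sum>\<^sub>i \<partial>\<^sub>j u\<^sub>i \<partial>\<^sub>i \<mu>\<close>.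
  On the other side \<open>(2 D(u) - curl u)\<^sub>i\<^sub>j = 2 \<partial>\<^sub>j u\<^sub>i\<close>, and the relation \<open>\<lambda> = 2 \<rho> \<mu>' - 2 \<mu>\<close> makes
  \<open>div (2 \<mu> D(u)) - div (\<mu> curl u) + \<nabla>(\<lambda> div u)\<close> exactly the negative of that expression.
\<close>

section \<open>Symmetry of second derivatives\<close>

abbreviation dir_deriv :: "('a::real_normed_vector \<Rightarrow> 'b::real_normed_vector) \<Rightarrow> 'a \<Rightarrow> 'a \<Rightarrow> 'b" where
  "dir_deriv f b x \<equiv> frechet_derivative f (at x) b"

lemma has_real_derivative_along:
  fixes F :: "'a::real_normed_vector \<Rightarrow> real"
  assumes "F differentiable at (p + s *\<^sub>R a)"
  shows "((\<lambda>s. F (p + s *\<^sub>R a)) has_real_derivative dir_deriv F a (p + s *\<^sub>R a)) (at s)"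
proof -
  let ?F' = "frechet_derivative F (at (p + s *\<^sub>R a))"
  have F: "(F has_derivative ?F') (at (p + s *\<^sub>R a))"
    using assms frechet_derivative_works by blast
  have "((\<lambda>s. p + s *\<^sub>R a) has_derivative (\<lambda>h. h *\<^sub>R a)) (at s)"
    by (auto intro!: derivative_eq_intros)
  from has_derivative_compose[OF this F]
  have "((\<lambda>s. F (p + s *\<^sub>R a)) has_derivative (\<lambda>h. ?F' (h *\<^sub>R a))) (at s)" .
  moreover have "?F' (h *\<^sub>R a) = ?F' a * h" for h
    using linear_frechet_derivative[OF assms] by (simp add: linear_cmul)
  ultimately show ?thesis
    by (simp add: has_field_derivative_def)
qed

text \<open>The mean value theorem is applied twice: along \<open>a\<close> to the increment of
  \<open>F\<close> over \<open>h *\<^sub>R b\<close>, then along \<open>b\<close> to the derivative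
  of \<open>F\<close> in direction \<open>a\<close>.\<close>

lemma second_difference_mean_value:
  fixes F :: "'a::real_normed_vector \<Rightarrow> real"
  assumes h: "0 < h"
    and par: "\<And>s r. 0 \<le> s \<Longrightarrow> s \<le> h \<Longrightarrow> 0 \<le> r \<Longrightarrow> r \<le> h \<Longrightarrow> z + s *\<^sub>R a + r *\<^sub>R b \<in> S"
    and F: "\<And>x. x \<in> S \<Longrightarrow> F differentiable at x"
    and Fa: "\<And>x. x \<in> S \<Longrightarrow> dir_deriv F a differentiable at x"
  obtains s r where "0 < s" "s < h" "0 < r" "r < h"
    "F (z + h *\<^sub>R a + h *\<^sub>R b) - F (z + h *\<^sub>R a) - F (z + h *\<^sub>R b) + F z
      = h * h * dir_deriv (dir_deriv F a) b (z + s *\<^sub>R a + r *\<^sub>R b)"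
proof -
  define g where "g s = F ((z + h *\<^sub>R b) + s *\<^sub>R a) - F (z + s *\<^sub>R a)" for s
  have inS: "(z + h *\<^sub>R b) + s *\<^sub>R a \<in> S" "z + s *\<^sub>R a \<in> S" if "0 \<le> s" "s \<le> h" for s
    using par[of s h] par[of s 0] that h by (auto simp: add_ac)
  have "(g has_real_derivative (dir_deriv F a ((z + h *\<^sub>R b) + s *\<^sub>R a)
      - dir_deriv F a (z + s *\<^sub>R a))) (at s)" if "0 \<le> s" "s \<le> h" for s
    unfolding g_def by (intro DERIV_diff has_real_derivative_along F inS that)
  from MVT2[OF h this] obtain s where s: "0 < s" "s < h" and
    gs: "g h - g 0 = h * (dir_deriv F a ((z + h *\<^sub>R b) + s *\<^sub>R a) - dir_deriv F a (z + s *\<^sub>R a))"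
    by auto
  have "((\<lambda>r. dir_deriv F a ((z + s *\<^sub>R a) + r *\<^sub>R b)) has_real_derivative
      dir_deriv (dir_deriv F a) b ((z + s *\<^sub>R a) + r *\<^sub>R b)) (at r)" if "0 \<le> r" "r \<le> h" for r
    by (intro has_real_derivative_along Fa par) (use s that in auto)
  from MVT2[OF h this] obtain r where r: "0 < r" "r < h" and
    "dir_deriv F a ((z + s *\<^sub>R a) + h *\<^sub>R b) - dir_deriv F a (z + s *\<^sub>R a)
      = h * dir_deriv (dir_deriv F a) b (z + s *\<^sub>R a + r *\<^sub>R b)"
    by auto
  with gs have "g h - g 0 = h * h * dir_deriv (dir_deriv F a) b (z + s *\<^sub>R a + r *\<^sub>R b)"
    by (simp add: add_ac)
  then show ?thesis
    by (intro that[OF s r]) (simp add: g_def algebra_simps)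
qed

text \<open>The second difference is unchanged when \<open>a\<close> and \<open>b\<close> are
  swapped, so on each small parallelogram the two mixed derivatives take a common value, though at
  different points; continuity brings both points to \<open>z\<close>. Iterated directional
  derivatives are what \<open>Ck_on\<close> provides.\<close>

lemma dir_deriv_commute:
  fixes F :: "'a::real_normed_vector \<Rightarrow> real"
  assumes S: "open S" "z \<in> S"
    and F: "\<And>x. x \<in> S \<Longrightarrow> F differentiable at x"
    and Fa: "\<And>x. x \<in> S \<Longrightarrow> dir_deriv F a differentiable at x"
    and Fb: "\<And>x. x \<in> S \<Longrightarrow> dir_deriv F b differentiable at x"
    and cont: "continuous_on S (dir_deriv (dir_deriv F a) b)"
      "continuous_on S (dir_deriv (dir_deriv F b) a)"
  shows "dir_deriv (dir_deriv F a) b z = dir_deriv (dir_deriv F b) a z"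
proof (rule ccontr)
  let ?G = "dir_deriv (dir_deriv F a) b" and ?H = "dir_deriv (dir_deriv F b) a"
  assume neq: "?G z \<noteq> ?H z"
  \<comment> \<open>Half the gap: values within \<open>e\<close> of \<open>?G z\<close> and of
    \<open>?H z\<close> cannot coincide.\<close>
  define e where "e = \<bar>?G z - ?H z\<bar> / 2"
  have e: "0 < e" using neq by (simp add: e_def)
  have "isCont ?G z"
    using S cont(1) continuous_on_eq_continuous_at by blast
  then obtain d1 where d1: "0 < d1" "\<And>x. dist x z < d1 \<Longrightarrow> dist (?G x) (?G z) < e"
    using e unfolding continuous_at_eps_delta by blast
  have "isCont ?H z"
    using S cont(2) continuous_on_eq_continuous_at by blast
  then obtain d2 where d2: "0 < d2" "\<And>x. dist x z < d2 \<Longrightarrow> dist (?H x) (?H z) < e"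
    using e unfolding continuous_at_eps_delta by blast
  obtain d3 where d3: "0 < d3" "ball z d3 \<subseteq> S"
    using S open_contains_ball by blast
  define m where "m = min d1 (min d2 d3)"
  have m: "0 < m" using d1 d2 d3 by (simp add: m_def)
  \<comment> \<open>Keeps the parallelogram spanned from \<open>z\<close> within distance
    \<open>m\<close>; the \<open>+ 1\<close> makes the bound strict and the denominator positive
    even for zero vectors.\<close>
  define h where "h = m / (norm a + norm b + 1)"
  have pos: "0 < norm a + norm b + 1" by (simp add: add_nonneg_pos)
  have h: "0 < h" using m pos by (simp add: h_def)
  have near: "dist (z + s *\<^sub>R a + r *\<^sub>R b) z < m" if "0 \<le> s" "s \<le> h" "0 \<le> r" "r \<le> h" for s r
  proof -
    have "dist (z + s *\<^sub>R a + r *\<^sub>R b) z \<le> norm (s *\<^sub>R a) + norm (r *\<^sub>R b)"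
      unfolding dist_norm by (metis add.commute add_diff_cancel add.assoc norm_triangle_ineq)
    also have "\<dots> \<le> h * norm a + h * norm b"
      using that by (auto intro!: add_mono mult_right_mono)
    also have "\<dots> < h * (norm a + norm b + 1)"
      using h by (simp add: algebra_simps)
    also have "\<dots> = m" using pos by (simp add: h_def)
    finally show ?thesis .
  qed
  have inS: "z + s *\<^sub>R a + r *\<^sub>R b \<in> S" if "0 \<le> s" "s \<le> h" "0 \<le> r" "r \<le> h" for s r
    using near[OF that] d3 by (auto simp: m_def dist_commute)
  obtain s r where sr: "0 < s" "s < h" "0 < r" "r < h"
    "F (z + h *\<^sub>R a + h *\<^sub>R b) - F (z + h *\<^sub>R a) - F (z + h *\<^sub>R b) + F z
      = h * h * ?G (z + s *\<^sub>R a + r *\<^sub>R b)"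
    using second_difference_mean_value[of h z a b S F] h inS F Fa by blast
  have inS': "z + s *\<^sub>R b + r *\<^sub>R a \<in> S" if "0 \<le> s" "s \<le> h" "0 \<le> r" "r \<le> h" for s r
    using inS[of r s] that by (simp add: add_ac)
  obtain s' r' where sr': "0 < s'" "s' < h" "0 < r'" "r' < h"
    "F (z + h *\<^sub>R b + h *\<^sub>R a) - F (z + h *\<^sub>R b) - F (z + h *\<^sub>R a) + F z
      = h * h * ?H (z + s' *\<^sub>R b + r' *\<^sub>R a)"
    using second_difference_mean_value[of h z b a S F] h inS' F Fb by blast
  have "h * h * ?G (z + s *\<^sub>R a + r *\<^sub>R b) = h * h * ?H (z + r' *\<^sub>R a + s' *\<^sub>R b)"
    using sr(5) sr'(5) by (simp add: algebra_simps)
  then have "?G (z + s *\<^sub>R a + r *\<^sub>R b) = ?H (z + r' *\<^sub>R a + s' *\<^sub>R b)"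
    using h by simp
  moreover have "dist (?G (z + s *\<^sub>R a + r *\<^sub>R b)) (?G z) < e"
    using near[of s r] sr by (intro d1) (auto simp: m_def)
  moreover have "dist (?H (z + r' *\<^sub>R a + s' *\<^sub>R b)) (?H z) < e"
    using near[of r' s'] sr' by (intro d2) (auto simp: m_def)
  ultimately show False
    unfolding e_def dist_real_def by argo
qed

section \<open>Smooth functions\<close>

lemma Ck_on_subset: "Ck_on k U f \<Longrightarrow> V \<subseteq> U \<Longrightarrow> Ck_on k V f"
  by (induction k arbitrary: f) (auto intro: continuous_on_subset)

section \<open>Locality of derivatives on open sets\<close>

lemma has_derivative_cong_open:
  assumes "open V" "x \<in> V" "\<And>y. y \<in> V \<Longrightarrow> f y = g y"
  shows "(f has_derivative f') (at x) \<longleftrightarrow> (g has_derivative f') (at x)"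
  using has_derivative_transform_within_open[of f f' x UNIV V g]
    has_derivative_transform_within_open[of g f' x UNIV V f] assms by auto

lemma frechet_derivative_cong_open:
  assumes "open V" "x \<in> V" "\<And>y. y \<in> V \<Longrightarrow> f y = g y"
  shows "frechet_derivative f (at x) = frechet_derivative g (at x)"
  using has_derivative_cong_open[of V x f g] assms by (simp add: frechet_derivative_def)

lemma differentiable_cong_open:
  assumes "open V" "x \<in> V" "\<And>y. y \<in> V \<Longrightarrow> f y = g y"
  shows "f differentiable (at x) \<longleftrightarrow> g differentiable (at x)"
  using has_derivative_cong_open[of V x f g] assms by (simp add: differentiable_def)

lemma Ck_on_cong:
  "open V \<Longrightarrow> \<forall>y\<in>V. f y = g y \<Longrightarrow> Ck_on k V f \<longleftrightarrow> Ck_on k V g"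
proof (induction k arbitrary: f g)
  case 0
  then show ?case by (auto cong: continuous_on_cong)
next
  case (Suc k)
  have "dir_deriv f b y = dir_deriv g b y" if "y \<in> V" for b y
    using frechet_derivative_cong_open[OF Suc.prems(1) that, of f g] Suc.prems(2) by simp
  then have "Ck_on k V (dir_deriv f b) \<longleftrightarrow> Ck_on k V (dir_deriv g b)" for b
    using Suc.IH[OF Suc.prems(1), of "dir_deriv f b" "dir_deriv g b"] by simp
  moreover have "f differentiable at x \<longleftrightarrow> g differentiable at x" if "x \<in> V" for x
    using differentiable_cong_open[OF Suc.prems(1) that, of f g] Suc.prems(2) by simp
  ultimately show ?case by simp
qed

text \<open>\<open>smooth_on\<close> differentiates an extension \<open>g\<close>, not
  \<open>f\<close>. Derivatives at points of an open \<open>V\<close> see only values near those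
  points, where \<open>g\<close> and \<open>f\<close> agree, so every order passes from
  \<open>g\<close> to \<open>f\<close>.\<close>

lemma smooth_on_imp_Ck_on:
  assumes "smooth_on S f" "open V" "V \<subseteq> S"
  shows "Ck_on k V f"
proof -
  obtain U g where "S \<subseteq> U" "\<forall>k. Ck_on k U g" "\<forall>x\<in>S. g x = f x"
    using assms(1) unfolding smooth_on_def by (elim exE conjE)
  then have "Ck_on k V g" "\<forall>y\<in>V. f y = g y"
    using Ck_on_subset[of k U g V] assms(3) by auto
  then show ?thesis
    using Ck_on_cong[OF assms(2), of f g] by simp
qed

lemma Ck_on_vec_nth:
  fixes f :: "'a::euclidean_space \<Rightarrow> real^'n"
  assumes "open V" "Ck_on k V f"
  shows "Ck_on k V (\<lambda>x. f x $ i)"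
  using assms(2)
proof (induction k arbitrary: f)
  case 0
  then show ?case by (simp add: continuous_on_component)
next
  case (Suc k)
  have *: "((\<lambda>x. f x $ i) has_derivative (\<lambda>h. frechet_derivative f (at x) h $ i)) (at x)"
    if "x \<in> V" for x
  proof -
    have "(f has_derivative frechet_derivative f (at x)) (at x)"
      using Suc.prems that frechet_derivative_works by auto
    then show ?thesis
      by (rule bounded_linear.has_derivative[OF bounded_linear_vec_nth])
  qed
  then have "dir_deriv (\<lambda>x. f x $ i) b x = dir_deriv f b x $ i" if "x \<in> V" for b x
    using frechet_derivative_at[OF *[OF that]] by metis
  moreover have "Ck_on k V (\<lambda>x. dir_deriv f b x $ i)" if "b \<in> Basis" for b
    using Suc that by auto
  ultimately have "Ck_on k V (dir_deriv (\<lambda>x. f x $ i) b)" if "b \<in> Basis" for b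
    using Ck_on_cong[OF assms(1), of "dir_deriv (\<lambda>x. f x $ i) b" "\<lambda>x. dir_deriv f b x $ i"] that
    by simp
  then show ?case
    using * by (auto simp: differentiable_def)
qed

lemma smooth_on_deriv:
  fixes f :: "real \<Rightarrow> real"
  assumes "smooth_on S f" "open S" "x \<in> S"
  shows "(f has_real_derivative deriv f x) (at x)"
    and "(deriv f has_real_derivative deriv (deriv f) x) (at x)"
proof -
  have C: "Ck_on (Suc (Suc 0)) S f"
    using assms smooth_on_imp_Ck_on by blast
  have D: "(f has_real_derivative deriv f y) (at y)" if "y \<in> S" for y
    using C that DERIV_deriv_iff_real_differentiable by auto
  then show "(f has_real_derivative deriv f x) (at x)"
    using assms by blast
  have "dir_deriv f 1 y = deriv f y" if "y \<in> S" for y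
    using frechet_derivative_at[OF D[OF that, unfolded has_field_derivative_def]] by (metis mult.right_neutral)
  moreover have "dir_deriv f 1 differentiable at x"
    using C assms by auto
  ultimately have "deriv f differentiable at x"
    using differentiable_cong_open[OF assms(2,3), of "dir_deriv f 1" "deriv f"] by simp
  then show "(deriv f has_real_derivative deriv (deriv f) x) (at x)"
    by (simp add: DERIV_deriv_iff_real_differentiable)
qed

section \<open>Partial derivatives in space and time\<close>

lemma pd_eq: "(f has_derivative f') (at x) \<Longrightarrow> pd i f x = f' (axis i 1)"
  unfolding pd_def using frechet_derivative_at by metis

lemma has_derivative_frechet: "f differentiable at x \<Longrightarrow> (f has_derivative frechet_derivative f (at x)) (at x)"
  using frechet_derivative_works by blast

text \<open>The chain rule with the embedding of space at time \<open>t\<close> turns a partial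
  derivative at frozen time into a space-time directional derivative, to which symmetry
  applies.\<close>

lemma pd_slice:
  fixes G :: "real \<times> (real^'n::finite) \<Rightarrow> real"
  assumes "G differentiable at (t, x)"
  shows "(\<lambda>y. G (t, y)) differentiable at x"
    and "pd i (\<lambda>y. G (t, y)) x = dir_deriv G (0, axis i 1) (t, x)"
proof -
  have "((\<lambda>y. (t, y)) has_derivative (\<lambda>h. (0, h))) (at x)"
    by (auto intro!: derivative_eq_intros)
  moreover have "(G has_derivative frechet_derivative G (at (t, x))) (at (t, x))"
    using assms frechet_derivative_works by blast
  ultimately have D: "((\<lambda>y. G (t, y)) has_derivative (\<lambda>h. frechet_derivative G (at (t, x)) (0, h))) (at x)"
    by (rule has_derivative_compose)
  then show "(\<lambda>y. G (t, y)) differentiable at x"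
    by (rule differentiableI)
  show "pd i (\<lambda>y. G (t, y)) x = dir_deriv G (0, axis i 1) (t, x)"
    using pd_eq[OF D] by simp
qed

lemma has_real_derivative_time_slice:
  fixes G :: "real \<times> (real^'n::finite) \<Rightarrow> real"
  assumes "G differentiable at (t, x)"
  shows "((\<lambda>s. G (s, x)) has_real_derivative dir_deriv G (1, 0) (t, x)) (at t)"
  using has_real_derivative_along[of G "(0, x)" t "(1, 0)"] assms by simp

lemma dt_eq:
  fixes f :: "real \<Rightarrow> real^'n::finite \<Rightarrow> real"
  assumes "((\<lambda>s. f s x) has_real_derivative d) (at t)"
  shows "dt f t x = d"
  using assms unfolding dt_def
  by (intro vector_derivative_at) (simp add: has_real_derivative_iff_has_vector_derivative)

text \<open>Order two covers every derivative of density and velocity that occurs below and is what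
  symmetry of mixed derivatives asks for.\<close>

locale C2_field =
  fixes I :: "real set" and f :: "real \<Rightarrow> real^'n::finite \<Rightarrow> real"
  assumes open_I: "open I"
    and C2: "Ck_on (Suc (Suc 0)) (I \<times> UNIV) (\<lambda>(t, x). f t x)"
begin

abbreviation "F \<equiv> \<lambda>(t, x). f t x"

lemma F_differentiable: "z \<in> I \<times> UNIV \<Longrightarrow> F differentiable at z"
  using C2 by auto

lemma dir_deriv_differentiable:
  "b \<in> Basis \<Longrightarrow> z \<in> I \<times> UNIV \<Longrightarrow> dir_deriv F b differentiable at z"
  using C2 by auto

lemma dir_deriv_F_commute:
  assumes "a \<in> Basis" "b \<in> Basis" "z \<in> I \<times> UNIV"
  shows "dir_deriv (dir_deriv F a) b z = dir_deriv (dir_deriv F b) a z"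
proof (rule dir_deriv_commute)
  show "open (I \<times> (UNIV :: (real^'n) set))"
    using open_I by (simp add: open_Times)
qed (use assms C2 F_differentiable dir_deriv_differentiable in auto)

lemma basis_time: "(1, 0) \<in> (Basis :: (real \<times> (real^'n)) set)"
  by (simp add: Basis_prod_def)

lemma basis_space: "(0, axis i 1) \<in> (Basis :: (real \<times> (real^'n)) set)"
  by (simp add: Basis_prod_def)

context
  fixes t assumes t: "t \<in> I"
begin

lemma differentiable_space: "f t differentiable at x"
  using pd_slice(1)[OF F_differentiable, of t x] t by simp

lemma pd_eq_dir_deriv: "pd i (f t) x = dir_deriv F (0, axis i 1) (t, x)"
  using pd_slice(2)[OF F_differentiable, of t x i] t by simp

lemma dt_eq_dir_deriv: "dt f t x = dir_deriv F (1, 0) (t, x)"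
  using has_real_derivative_time_slice[OF F_differentiable, of t x] t
  by (intro dt_eq) simp

lemma has_real_derivative_time: "((\<lambda>s. f s x) has_real_derivative dt f t x) (at t)"
  using has_real_derivative_time_slice[OF F_differentiable, of t x] t
  by (simp add: dt_eq_dir_deriv)

end

context
  fixes t assumes t: "t \<in> I"
begin

lemma pd_differentiable_space: "pd i (f t) differentiable at x"
  and pd_pd_eq_dir_deriv: "pd j (pd i (f t)) x = dir_deriv (dir_deriv F (0, axis i 1)) (0, axis j 1) (t, x)"
proof -
  have "pd i (f t) = (\<lambda>y. dir_deriv F (0, axis i 1) (t, y))"
    by (rule ext) (rule pd_eq_dir_deriv[OF t])
  then show "pd i (f t) differentiable at x"
    "pd j (pd i (f t)) x = dir_deriv (dir_deriv F (0, axis i 1)) (0, axis j 1) (t, x)"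
    using pd_slice[OF dir_deriv_differentiable[OF basis_space], of t x] t by simp_all
qed

lemma dt_differentiable_space: "dt f t differentiable at x"
  and pd_dt_eq_dir_deriv: "pd j (dt f t) x = dir_deriv (dir_deriv F (1, 0)) (0, axis j 1) (t, x)"
proof -
  have "dt f t = (\<lambda>y. dir_deriv F (1, 0) (t, y))"
    by (rule ext) (rule dt_eq_dir_deriv[OF t])
  then show "dt f t differentiable at x"
    "pd j (dt f t) x = dir_deriv (dir_deriv F (1, 0)) (0, axis j 1) (t, x)"
    using pd_slice[OF dir_deriv_differentiable[OF basis_time], of t x] t by simp_all
qed

text \<open>Symmetry for the directions \<open>(1, 0)\<close> and \<open>(0, axis i 1)\<close>. The
  slice formula \<open>pd_eq_dir_deriv\<close> is used at all times near \<open>t\<close>, hence its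
  proof in a context closed beforehand.\<close>

lemma has_real_derivative_pd_time:
  "((\<lambda>s. pd i (f s) x) has_real_derivative pd i (dt f t) x) (at t)"
proof (rule has_field_derivative_transform_within_open[OF _ open_I t])
  show "((\<lambda>s. dir_deriv F (0, axis i 1) (s, x)) has_real_derivative pd i (dt f t) x) (at t)"
    using has_real_derivative_time_slice[OF dir_deriv_differentiable[OF basis_space], of t x i] t
      dir_deriv_F_commute[OF basis_space basis_time, of "(t, x)" i]
    by (simp add: pd_dt_eq_dir_deriv)
qed (simp add: pd_eq_dir_deriv)

lemma pd_commute: "pd i (pd j (f t)) x = pd j (pd i (f t)) x"
  using dir_deriv_F_commute[OF basis_space basis_space, of "(t, x)"] t
  by (simp add: pd_pd_eq_dir_deriv)

end

end

section \<open>Calculus rules for partial and time derivatives\<close>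

lemma pd_add: "f differentiable at x \<Longrightarrow> g differentiable at x \<Longrightarrow>
    pd i (\<lambda>y. f y + g y) x = pd i f x + pd i g x"
  by (subst pd_eq[OF has_derivative_add[OF has_derivative_frechet has_derivative_frechet]])
    (simp_all add: pd_def)

lemma pd_diff: "f differentiable at x \<Longrightarrow> g differentiable at x \<Longrightarrow>
    pd i (\<lambda>y. f y - g y) x = pd i f x - pd i g x"
  by (subst pd_eq[OF has_derivative_diff[OF has_derivative_frechet has_derivative_frechet]])
    (simp_all add: pd_def)

lemma pd_mult: "f differentiable at x \<Longrightarrow> g differentiable at x \<Longrightarrow>
    pd i (\<lambda>y. f y * g y) x = pd i f x * g x + f x * pd i g x"
  by (subst pd_eq[OF has_derivative_mult[OF has_derivative_frechet has_derivative_frechet]])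
    (simp_all add: pd_def)

lemma pd_const: "pd i (\<lambda>y. c) x = 0"
  by (simp add: pd_def)

lemma pd_minus: "f differentiable at x \<Longrightarrow> pd i (\<lambda>y. - f y) x = - pd i f x"
  by (subst pd_eq[OF has_derivative_minus[OF has_derivative_frechet]]) (simp_all add: pd_def)

lemma pd_sum:
  assumes "\<And>k. k \<in> K \<Longrightarrow> f k differentiable at x"
  shows "pd i (\<lambda>y. \<Sum>k\<in>K. f k y) x = (\<Sum>k\<in>K. pd i (f k) x)"
  by (subst pd_eq[OF has_derivative_sum[OF has_derivative_frechet[OF assms]]])
    (simp_all add: pd_def)

lemma pd_compose:
  fixes h :: "real \<Rightarrow> real"
  assumes "(h has_real_derivative h') (at (f x))" "f differentiable at x"
  shows "pd i (\<lambda>y. h (f y)) x = h' * pd i f x" and "(\<lambda>y. h (f y)) differentiable at x"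
proof -
  have "(f has_derivative frechet_derivative f (at x)) (at x)"
    using assms frechet_derivative_works by blast
  from has_derivative_compose[OF this assms(1)[unfolded has_field_derivative_def]]
  have D: "((\<lambda>y. h (f y)) has_derivative (\<lambda>b. h' * frechet_derivative f (at x) b)) (at x)" .
  then show "(\<lambda>y. h (f y)) differentiable at x"
    by (rule differentiableI)
  show "pd i (\<lambda>y. h (f y)) x = h' * pd i f x"
    using pd_eq[OF D] by (simp add: pd_def)
qed

text \<open>\<open>vector_derivative\<close> is meaningful only for a differentiable curve;
  differentiability of all components provides this, and the projection is bounded linear.\<close>

lemma dt_vec_nth:
  fixes w :: "real \<Rightarrow> real^'n::finite \<Rightarrow> real^'n"
  assumes "\<And>i. (\<lambda>s. w s x $ i) differentiable at t"
  shows "dt w t x $ j = dt (\<lambda>s y. w s y $ j) t x"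
proof -
  have "(\<lambda>s. w s x) differentiable at t"
    using assms by (subst differentiable_componentwise_within) (auto simp: Basis_vec_def inner_axis)
  then have "((\<lambda>s. w s x) has_vector_derivative dt w t x) (at t)"
    unfolding dt_def vector_derivative_works .
  then have "((\<lambda>s. w s x $ j) has_vector_derivative dt w t x $ j) (at t)"
    by (rule bounded_linear.has_vector_derivative[OF bounded_linear_vec_nth])
  then show ?thesis
    by (intro dt_eq[symmetric]) (simp add: has_real_derivative_iff_has_vector_derivative)
qed

section \<open>The effective velocity\<close>

locale effective_velocity =
  fixes \<mu> lam \<phi> :: "real \<Rightarrow> real" and I :: "real set"
    and \<rho> :: "real \<Rightarrow> real^'n::finite \<Rightarrow> real" and u v :: "real \<Rightarrow> real^'n \<Rightarrow> real^'n"
  assumes \<rho>_C2: "C2_field I \<rho>"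
    and u_C2: "C2_field I (\<lambda>t x. u t x $ i)"
    and \<rho>_pos: "t \<in> I \<Longrightarrow> 0 < \<rho> t x"
    and \<mu>_deriv: "0 < r \<Longrightarrow> (\<mu> has_real_derivative deriv \<mu> r) (at r)"
    and \<mu>_deriv2: "0 < r \<Longrightarrow> (deriv \<mu> has_real_derivative deriv (deriv \<mu>) r) (at r)"
    and lam_eq: "0 < r \<Longrightarrow> lam r = 2 * r * deriv \<mu> r - 2 * \<mu> r"
    and \<phi>_deriv: "0 < r \<Longrightarrow> (\<phi> has_real_derivative 2 * deriv \<mu> r / r) (at r)"
    and v_eq: "t \<in> I \<Longrightarrow> v t x = u t x + grad (\<lambda>y. \<phi> (\<rho> t y)) x"
begin

sublocale R: C2_field I \<rho>
  by (rule \<rho>_C2)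

sublocale U: C2_field I "\<lambda>t x. u t x $ i" for i
  by (rule u_C2)

text \<open>For positive arguments this is the first derivative of \<open>\<phi>\<close>, and
  \<open>\<kappa>'\<close> the second, so the correction in \<open>v\<close> becomes
  \<open>\<kappa>\<close> of the density times its gradient.\<close>

definition \<kappa> :: "real \<Rightarrow> real" where "\<kappa> r = 2 * deriv \<mu> r / r"

definition \<kappa>' :: "real \<Rightarrow> real" where
  "\<kappa>' r = 2 * deriv (deriv \<mu>) r / r - 2 * deriv \<mu> r / (r * r)"

lemma \<kappa>_deriv: "0 < r \<Longrightarrow> (\<kappa> has_real_derivative \<kappa>' r) (at r)"
  unfolding \<kappa>_def[abs_def] \<kappa>'_def
  by (auto intro!: derivative_eq_intros \<mu>_deriv2 simp: field_simps)

context
  fixes t assumes t: "t \<in> I"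
begin

lemmas differentiable_intros =
  R.differentiable_space[OF t] R.pd_differentiable_space[OF t] R.dt_differentiable_space[OF t]
  U.differentiable_space[OF t] U.pd_differentiable_space[OF t]
  pd_compose(2)[where h=\<mu>, OF \<mu>_deriv[OF \<rho>_pos[OF t]] R.differentiable_space[OF t]]
  pd_compose(2)[where h="deriv \<mu>", OF \<mu>_deriv2[OF \<rho>_pos[OF t]] R.differentiable_space[OF t]]
  pd_compose(2)[where h=\<kappa>, OF \<kappa>_deriv[OF \<rho>_pos[OF t]] R.differentiable_space[OF t]]

lemmas pd_rules = pd_add pd_diff pd_mult pd_const pd_sum
  pd_compose(1)[where h=\<mu>, OF \<mu>_deriv[OF \<rho>_pos[OF t]] R.differentiable_space[OF t]]
  pd_compose(1)[where h="deriv \<mu>", OF \<mu>_deriv2[OF \<rho>_pos[OF t]] R.differentiable_space[OF t]]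
  pd_compose(1)[where h=\<kappa>, OF \<kappa>_deriv[OF \<rho>_pos[OF t]] R.differentiable_space[OF t]]

lemma v_nth: "v t x $ j = u t x $ j + \<kappa> (\<rho> t x) * pd j (\<rho> t) x"
  using pd_compose(1)[where h=\<phi>, OF \<phi>_deriv[OF \<rho>_pos[OF t]] R.differentiable_space[OF t]]
  by (simp add: v_eq[OF t] grad_def \<kappa>_def)

lemma velocity_of_eq: "velocity_of \<phi> \<rho> v t x = u t x"
  by (simp add: velocity_of_def v_eq[OF t])

lemma pd_v: "pd i (\<lambda>y. v t y $ j) x = pd i (\<lambda>y. u t y $ j) x
    + \<kappa>' (\<rho> t x) * pd i (\<rho> t) x * pd j (\<rho> t) x + \<kappa> (\<rho> t x) * pd i (pd j (\<rho> t)) x"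
  by (simp add: v_nth pd_rules differentiable_intros)

text \<open>The terms that \<open>pd_v\<close> adds to the derivatives of \<open>u\<close> are
  symmetric in \<open>i\<close> and \<open>j\<close>, as for any gradient.\<close>

lemma curl_v: "curl (v t) x = curl (u t) x"
  by (simp add: curl_def vec_eq_iff pd_v R.pd_commute[OF t] mult_ac)

text \<open>The mixed derivative is written with the space derivative outermost, so that the mass
  equation can be inserted for \<open>dt \<rho>\<close>.\<close>

lemma has_real_derivative_v_nth:
  "((\<lambda>s. v s x $ j) has_real_derivative dt (\<lambda>s y. u s y $ j) t x
    + (\<kappa>' (\<rho> t x) * dt \<rho> t x * pd j (\<rho> t) x + \<kappa> (\<rho> t x) * pd j (dt \<rho> t) x)) (at t)"
    (is "(_ has_real_derivative ?d) _")
proof -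
  have "((\<lambda>s. u s x $ j + \<kappa> (\<rho> s x) * pd j (\<rho> s) x) has_real_derivative ?d) (at t)"
    using DERIV_chain2[OF \<kappa>_deriv[OF \<rho>_pos[OF t]] R.has_real_derivative_time[OF t, of x]]
    by (auto intro!: DERIV_add U.has_real_derivative_time[OF t]
        derivative_eq_intros R.has_real_derivative_pd_time[OF t])
  then show ?thesis
    \<comment> \<open>The formula for \<open>v\<close> must hold at all times near \<open>t\<close>,
      so \<open>v_nth\<close> is taken in its exported form, not at the fixed time.\<close>
    by (rule has_field_derivative_transform_within_open[OF _ R.open_I t])
      (simp add: effective_velocity.v_nth[OF effective_velocity_axioms])
qed

lemma dt_v_nth: "dt v t x $ j = dt (\<lambda>s y. u s y $ j) t x
    + (\<kappa>' (\<rho> t x) * dt \<rho> t x * pd j (\<rho> t) x + \<kappa> (\<rho> t x) * pd j (dt \<rho> t) x)"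
proof -
  have "(\<lambda>s. v s x $ i) differentiable at t" for i
    using has_real_derivative_v_nth real_differentiable_def by blast
  then have "dt v t x $ j = dt (\<lambda>s y. v s y $ j) t x"
    by (rule dt_vec_nth)
  then show ?thesis
    using dt_eq[OF has_real_derivative_v_nth] by simp
qed

lemma dt_momentum_nth:
  "dt (\<lambda>s y. \<rho> s y *\<^sub>R u s y) t x $ j = dt \<rho> t x * u t x $ j + \<rho> t x * dt (\<lambda>s y. u s y $ j) t x"
proof -
  have *: "((\<lambda>s. (\<rho> s x *\<^sub>R u s x) $ i) has_real_derivative
      dt \<rho> t x * u t x $ i + \<rho> t x * dt (\<lambda>s y. u s y $ i) t x) (at t)" for i
    using DERIV_mult[OF R.has_real_derivative_time[OF t, of x]
        U.has_real_derivative_time[OF t, of x i]]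
    by (simp add: mult_ac)
  then have "(\<lambda>s. (\<rho> s x *\<^sub>R u s x) $ i) differentiable at t" for i
    using real_differentiable_def by blast
  then have "dt (\<lambda>s y. \<rho> s y *\<^sub>R u s y) t x $ j = dt (\<lambda>s y. (\<rho> s y *\<^sub>R u s y) $ j) t x"
    by (rule dt_vec_nth)
  also have "\<dots> = dt \<rho> t x * u t x $ j + \<rho> t x * dt (\<lambda>s y. u s y $ j) t x"
    by (rule dt_eq) (rule *)
  finally show ?thesis .
qed

section \<open>The mass equation in the two velocities\<close>

lemma divergence_flux:
  "divergence (\<lambda>y. \<rho> t y *\<^sub>R u t y) x
    = (\<Sum>i\<in>UNIV. pd i (\<rho> t) x * u t x $ i) + \<rho> t x * divergence (u t) x"
  by (simp add: divergence_def pd_rules differentiable_intros sum.distrib sum_distrib_left)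

text \<open>Since \<rho> times \<open>\<kappa>\<close> is \<open>2 * deriv \<mu>\<close>, the two
  fluxes differ by twice the gradient of \<mu>(\<rho>), whose divergence is the Laplacian
  term.\<close>

lemma divergence_effective_flux:
  "divergence (\<lambda>y. \<rho> t y *\<^sub>R v t y) x
    = divergence (\<lambda>y. \<rho> t y *\<^sub>R u t y) x + 2 * laplacian (\<lambda>y. \<mu> (\<rho> t y)) x"
proof -
  have "\<rho> t y * v t y $ i = \<rho> t y * u t y $ i + 2 * (deriv \<mu> (\<rho> t y) * pd i (\<rho> t) y)" for i y
    using \<rho>_pos[OF t, of y] by (simp add: v_nth \<kappa>_def field_simps)
  then show ?thesis
    by (simp add: divergence_def laplacian_def grad_def pd_rules differentiable_intros
        sum.distrib sum_distrib_left)
qed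

lemma mass_iff:
  "dt \<rho> t x + divergence (\<lambda>y. \<rho> t y *\<^sub>R u t y) x = 0 \<longleftrightarrow>
   dt \<rho> t x - 2 * laplacian (\<lambda>y. \<mu> (\<rho> t y)) x + divergence (\<lambda>y. \<rho> t y *\<^sub>R v t y) x = 0"
  by (simp add: divergence_effective_flux)

section \<open>Componentwise expansion of the momentum terms\<close>

lemma pd_divergence_u:
  "pd j (divergence (u t)) x = (\<Sum>i\<in>UNIV. pd j (pd i (\<lambda>y. u t y $ i)) x)"
  and differentiable_divergence_u: "divergence (u t) differentiable at x"
  by (simp_all add: divergence_def[abs_def] pd_rules differentiable_intros)

text \<open>The first two terms are div(\<rho> u) times a component of \<open>u\<close>; the mass
  equation later cancels them against the density term of \<open>dt_momentum_nth\<close>.\<close>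

lemma mdiv_tensor_nth:
  "mdiv (\<lambda>y. \<rho> t y *\<^sub>R tensor (u t y) (u t y)) x $ j
    = (\<Sum>i\<in>UNIV. pd i (\<rho> t) x * u t x $ i) * u t x $ j + \<rho> t x * divergence (u t) x * u t x $ j
      + \<rho> t x * convect (u t) (u t) x $ j"
  by (simp add: mdiv_def tensor_def divergence_def convect_def pd_rules differentiable_intros
      sum.distrib sum_distrib_left sum_distrib_right algebra_simps)

text \<open>Entry (i, j) of 2 D(u) - curl u is twice the j-th derivative of the i-th component. The
  product rule gives the sum, and commuting derivatives turns the rest into the gradient of the
  divergence.\<close>

lemma mdiv_strain_nth:
  "mdiv (\<lambda>y. (2 * \<mu> (\<rho> t y)) *\<^sub>R strain (u t) y) x $ j
    = mdiv (\<lambda>y. \<mu> (\<rho> t y) *\<^sub>R curl (u t) y) x $ j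
      + 2 * deriv \<mu> (\<rho> t x) * (\<Sum>i\<in>UNIV. pd i (\<rho> t) x * pd j (\<lambda>y. u t y $ i) x)
      + 2 * \<mu> (\<rho> t x) * pd j (divergence (u t)) x"
  by (simp add: mdiv_def strain_def curl_def vgrad_def transpose_def pd_rules
      pd_divergence_u differentiable_intros U.pd_commute[OF t, of j]
      sum.distrib sum_distrib_left sum_distrib_right sum_subtractf algebra_simps)

text \<open>The relation for \<open>lam\<close> is inserted before differentiating; in the
  derivative of 2 r \<mu>' - 2 \<mu> the first-order terms cancel and 2 r \<mu>'' remains.\<close>

lemma grad_bulk_nth:
  "grad (\<lambda>y. lam (\<rho> t y) * divergence (u t) y) x $ j
    = 2 * \<rho> t x * deriv (deriv \<mu>) (\<rho> t x) * pd j (\<rho> t) x * divergence (u t) x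
      + (2 * \<rho> t x * deriv \<mu> (\<rho> t x) - 2 * \<mu> (\<rho> t x)) * pd j (divergence (u t)) x"
  by (simp add: grad_def lam_eq[OF \<rho>_pos[OF t]] pd_rules differentiable_intros
      differentiable_divergence_u algebra_simps)

lemma convect_v_nth:
  "convect (u t) (v t) x $ j = convect (u t) (u t) x $ j
    + \<kappa>' (\<rho> t x) * (\<Sum>i\<in>UNIV. pd i (\<rho> t) x * u t x $ i) * pd j (\<rho> t) x
    + \<kappa> (\<rho> t x) * (\<Sum>i\<in>UNIV. pd j (pd i (\<rho> t)) x * u t x $ i)"
  by (simp add: convect_def pd_v R.pd_commute[OF t, of j]
      sum.distrib sum_distrib_left sum_distrib_right algebra_simps)

text \<open>The mass equation is differentiated in space, hence assumed at every point. The first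
  sum will cancel the last one in \<open>convect_v_nth\<close>.\<close>

lemma pd_dt_density:
  assumes "\<And>y. dt \<rho> t y + divergence (\<lambda>y. \<rho> t y *\<^sub>R u t y) y = 0"
  shows "pd j (dt \<rho> t) x = - ((\<Sum>i\<in>UNIV. pd j (pd i (\<rho> t)) x * u t x $ i)
    + (\<Sum>i\<in>UNIV. pd i (\<rho> t) x * pd j (\<lambda>y. u t y $ i) x)
    + pd j (\<rho> t) x * divergence (u t) x + \<rho> t x * pd j (divergence (u t)) x)"
proof -
  let ?m = "\<lambda>y. (\<Sum>i\<in>UNIV. pd i (\<rho> t) y * u t y $ i) + \<rho> t y * divergence (u t) y"
  have "?m differentiable at x"
    by (simp add: differentiable_intros differentiable_divergence_u)
  moreover have "dt \<rho> t = (\<lambda>y. - ?m y)"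
    using assms by (intro ext) (simp add: divergence_flux add_eq_0_iff2)
  ultimately have "pd j (dt \<rho> t) x = - pd j ?m x"
    by (simp only: pd_minus)
  also have "pd j ?m x = (\<Sum>i\<in>UNIV. pd j (pd i (\<rho> t)) x * u t x $ i)
      + (\<Sum>i\<in>UNIV. pd i (\<rho> t) x * pd j (\<lambda>y. u t y $ i) x)
      + pd j (\<rho> t) x * divergence (u t) x + \<rho> t x * pd j (divergence (u t)) x"
    by (simp add: pd_rules differentiable_intros differentiable_divergence_u sum.distrib)
  finally show ?thesis .
qed

text \<open>The mass equation enters twice, through \<open>dt \<rho>\<close> and through its spatial
  gradient. The pressure gradient, common to both systems, is left out.\<close>

lemma momentum_balance:
  assumes mass: "\<And>y. dt \<rho> t y + divergence (\<lambda>y. \<rho> t y *\<^sub>R u t y) y = 0"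
  shows "dt (\<lambda>s y. \<rho> s y *\<^sub>R u s y) t x
        + mdiv (\<lambda>y. \<rho> t y *\<^sub>R tensor (u t y) (u t y)) x
        - mdiv (\<lambda>y. (2 * \<mu> (\<rho> t y)) *\<^sub>R strain (u t) y) x
        - grad (\<lambda>y. lam (\<rho> t y) * divergence (u t) y) x
    = \<rho> t x *\<^sub>R dt v t x
        + \<rho> t x *\<^sub>R convect (velocity_of \<phi> \<rho> v t) (v t) x
        - mdiv (\<lambda>y. \<mu> (\<rho> t y) *\<^sub>R curl (v t) y) x"
proof -
  have vel: "velocity_of \<phi> \<rho> v t = u t"
    by (rule ext) (rule velocity_of_eq)
  \<comment> \<open>Naming every derivative reduces the claim to a polynomial identity modulo the
    two relations for \<open>\<kappa>\<close> and \<open>\<kappa>'\<close> below.\<close>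
  define r p q m where "r = \<rho> t x" and "p = deriv \<mu> r" and "q = deriv (deriv \<mu>) r" and "m = \<mu> r"
  define S d where "S = (\<Sum>i\<in>UNIV. pd i (\<rho> t) x * u t x $ i)" and "d = divergence (u t) x"
  have "r \<noteq> 0" using \<rho>_pos[OF t, of x] by (simp add: r_def)
  have rt: "dt \<rho> t x = - (S + r * d)"
    using mass[of x] by (simp add: divergence_flux S_def r_def d_def add_eq_0_iff2)
  \<comment> \<open>The second relation is the derivative of the first with respect to
    \<open>r\<close>.\<close>
  have \<kappa>: "r * \<kappa> r = 2 * p" "r * \<kappa>' r = 2 * q - \<kappa> r"
    using \<open>r \<noteq> 0\<close> by (simp_all add: \<kappa>_def \<kappa>'_def p_def q_def field_simps)
  show ?thesis
  proof (rule vec_eq_iff[THEN iffD2], rule allI)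
    fix j
    define rj dj where "rj = pd j (\<rho> t) x" and "dj = pd j (divergence (u t)) x"
    define A B C M where "A = (\<Sum>i\<in>UNIV. pd j (pd i (\<rho> t)) x * u t x $ i)"
      and "B = (\<Sum>i\<in>UNIV. pd i (\<rho> t) x * pd j (\<lambda>y. u t y $ i) x)"
      and "C = convect (u t) (u t) x $ j"
      and "M = mdiv (\<lambda>y. \<mu> (\<rho> t y) *\<^sub>R curl (u t) y) x $ j"
    define uj ut where "uj = u t x $ j" and "ut = dt (\<lambda>s y. u s y $ j) t x"
    have rtj: "pd j (dt \<rho> t) x = - (A + B + rj * d + r * dj)"
      using pd_dt_density[OF mass] by (simp add: A_def B_def rj_def d_def r_def dj_def)
    \<comment> \<open>Starting from the effective side, \<open>S\<close> and \<open>A\<close> cancel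
      between time derivative and transport: the gradient commutes with the material derivative up
      to \<open>B\<close>.\<close>
    have "r * (ut + (\<kappa>' r * - (S + r * d) * rj + \<kappa> r * - (A + B + rj * d + r * dj)))
        + r * (C + \<kappa>' r * S * rj + \<kappa> r * A) - M
      = r * ut + r * C - M - r * (r * \<kappa>' r) * d * rj - (r * \<kappa> r) * (B + rj * d + r * dj)"
      by (simp add: algebra_simps)
    also have "\<dots> = r * ut + r * C - M - 2 * q * r * d * rj + (r * \<kappa> r) * d * rj
        - (r * \<kappa> r) * (B + rj * d + r * dj)"
      unfolding \<kappa>(2) by (simp add: algebra_simps)
    \<comment> \<open>The products \<open>2 * p * d * rj\<close> cancel;
      \<open>(S + r * d) * uj\<close> and \<open>2 * m * dj\<close> are added and subtracted to
      exhibit the conservative, strain and bulk terms.\<close>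
    also have "\<dots> = - (S + r * d) * uj + r * ut + (S * uj + r * d * uj + r * C)
        - (M + 2 * p * B + 2 * m * dj) - (2 * r * q * rj * d + (2 * r * p - 2 * m) * dj)"
      unfolding \<kappa>(1) by (simp add: algebra_simps)
    finally show "(dt (\<lambda>s y. \<rho> s y *\<^sub>R u s y) t x
        + mdiv (\<lambda>y. \<rho> t y *\<^sub>R tensor (u t y) (u t y)) x
        - mdiv (\<lambda>y. (2 * \<mu> (\<rho> t y)) *\<^sub>R strain (u t) y) x
        - grad (\<lambda>y. lam (\<rho> t y) * divergence (u t) y) x) $ j
      = (\<rho> t x *\<^sub>R dt v t x
        + \<rho> t x *\<^sub>R convect (velocity_of \<phi> \<rho> v t) (v t) x
        - mdiv (\<lambda>y. \<mu> (\<rho> t y) *\<^sub>R curl (v t) y) x) $ j"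
      unfolding vel curl_v vector_add_component vector_minus_component vector_scaleR_component
        real_scaleR_def dt_momentum_nth mdiv_tensor_nth mdiv_strain_nth grad_bulk_nth dt_v_nth
        convect_v_nth rt rtj
      \<comment> \<open>Folding \<open>r\<close> comes first because \<open>p\<close>,
        \<open>q\<close> and \<open>m\<close> are defined through it.\<close>
      unfolding r_def[symmetric]
      unfolding p_def[symmetric] q_def[symmetric] m_def[symmetric] S_def[symmetric] d_def[symmetric]
        rj_def[symmetric] dj_def[symmetric] A_def[symmetric] B_def[symmetric] C_def[symmetric]
        M_def[symmetric] uj_def[symmetric] ut_def[symmetric]
      by simp
  qed
qed

end

end


section \<open>From pointwise identities to the two systems\<close>

theorem proposition9:
  fixes \<mu> lam P \<phi> :: "real \<Rightarrow> real"
    and T :: ereal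
    and \<rho>0 :: "real^'n::finite \<Rightarrow> real" and u0 :: "real^'n \<Rightarrow> real^'n"
    and \<rho> :: "real \<Rightarrow> real^'n \<Rightarrow> real"
    and u v :: "real \<Rightarrow> real^'n \<Rightarrow> real^'n"
  assumes "CARD('n) \<ge> 2" and "0 < T"
    and "smooth_on {0<..} \<mu>" and "smooth_on {0<..} lam" and "smooth_on {0<..} P"
    and "\<And>r. 0 < r \<Longrightarrow> lam r = 2 * r * deriv \<mu> r - 2 * \<mu> r"
    and "\<And>r. 0 < r \<Longrightarrow> (\<phi> has_real_derivative 2 * deriv \<mu> r / r) (at r)"
    and "smooth_on ({t. 0 \<le> t \<and> ereal t < T} \<times> UNIV) (\<lambda>(t, x). \<rho> t x)"
    and "smooth_on ({t. 0 \<le> t \<and> ereal t < T} \<times> UNIV) (\<lambda>(t, x). u t x)"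
    and "\<And>t x. 0 \<le> t \<Longrightarrow> ereal t < T \<Longrightarrow> 0 < \<rho> t x"
    and "\<And>t x. 0 \<le> t \<Longrightarrow> ereal t < T \<Longrightarrow> v t x = u t x + grad (\<lambda>y. \<phi> (\<rho> t y)) x"
  shows "compressible_NS \<mu> lam P T \<rho>0 u0 \<rho> u \<longleftrightarrow> effective_NS \<mu> \<phi> P T \<rho>0 u0 \<rho> v"
proof -
  \<comment> \<open>The differential equations are imposed only for positive times, and without time
    0 the interval is open.\<close>
  define I where "I = {t. 0 < t \<and> ereal t < T}"
  have "open {t. ereal t < T}"
    by (intro open_Collect_less continuous_intros)
  then have I: "open I"
    unfolding I_def by (intro open_Collect_conj open_Collect_less continuous_intros)
  have sub: "I \<times> (UNIV :: (real^'n) set) \<subseteq> {t. 0 \<le> t \<and> ereal t < T} \<times> UNIV"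
    by (auto simp: I_def)
  have op: "open (I \<times> (UNIV :: (real^'n) set))"
    using I by (simp add: open_Times)
  have rho: "Ck_on k (I \<times> UNIV) (\<lambda>(t, x). \<rho> t x)" for k
    using smooth_on_imp_Ck_on[OF assms(8) op sub] .
  have u: "Ck_on k (I \<times> UNIV) (\<lambda>(t, x). u t x $ i)" for k i
    using Ck_on_vec_nth[OF op smooth_on_imp_Ck_on[OF assms(9) op sub], of k i]
    by (simp add: case_prod_unfold)
  interpret effective_velocity \<mu> lam \<phi> I \<rho> u v
  proof
    show "open I" "open I" by (rule I)+
    show "(\<mu> has_real_derivative deriv \<mu> r) (at r)"
      "(deriv \<mu> has_real_derivative deriv (deriv \<mu>) r) (at r)" if "0 < r" for r
      using smooth_on_deriv[OF assms(3), of r] that by auto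
  qed (use assms(6,7,10,11) rho u in \<open>auto simp: I_def\<close>)
  have mass: "(\<forall>t x. t \<in> I \<longrightarrow> dt \<rho> t x + divergence (\<lambda>y. \<rho> t y *\<^sub>R u t y) x = 0) \<longleftrightarrow>
      (\<forall>t x. t \<in> I \<longrightarrow> dt \<rho> t x - 2 * laplacian (\<lambda>y. \<mu> (\<rho> t y)) x
        + divergence (\<lambda>y. \<rho> t y *\<^sub>R v t y) x = 0)"
    using mass_iff by blast
  \<comment> \<open>Time 0 lies outside \<open>I\<close>; the relation between \<open>v\<close> and
    \<open>u\<close> holds there because \<open>0 < T\<close>.\<close>
  have init: "velocity_of \<phi> \<rho> v 0 x = u 0 x" for x
    using assms(11)[of 0 x] assms(2) by (simp add: velocity_of_def zero_ereal_def)
  have momentum: "dt (\<lambda>s y. \<rho> s y *\<^sub>R u s y) t x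
        + mdiv (\<lambda>y. \<rho> t y *\<^sub>R tensor (u t y) (u t y)) x
        - mdiv (\<lambda>y. (2 * \<mu> (\<rho> t y)) *\<^sub>R strain (u t) y) x
        - grad (\<lambda>y. lam (\<rho> t y) * divergence (u t) y) x
        + grad (\<lambda>y. P (\<rho> t y)) x
      = \<rho> t x *\<^sub>R dt v t x
        + \<rho> t x *\<^sub>R convect (velocity_of \<phi> \<rho> v t) (v t) x
        - mdiv (\<lambda>y. \<mu> (\<rho> t y) *\<^sub>R curl (v t) y) x
        + grad (\<lambda>y. P (\<rho> t y)) x"
    if "\<forall>t x. t \<in> I \<longrightarrow> dt \<rho> t x + divergence (\<lambda>y. \<rho> t y *\<^sub>R u t y) x = 0" "t \<in> I" for t x
    using momentum_balance[of t x] that by simp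
  have I_iff: "0 < t \<and> ereal t < T \<longleftrightarrow> t \<in> I" for t
    by (simp add: I_def)
  show ?thesis
    unfolding compressible_NS_def effective_NS_def init I_iff mass[symmetric]
    \<comment> \<open>With the mass equations identified, \<open>conj_cong\<close> allows the
      momentum equations to be compared under the common mass equation, in both directions.\<close>
    using momentum by (intro conj_cong refl) simp
qed

end
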